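(* Let $r\ge1$, let $v,z_i,z_j$ be nonzero complex numbers. The Yang–Baxter equation $$R(z_i,z_j)_{12}T(z_i)_{13}T(z_j)_{23}=T(z_j)_{23}T(z_i)_{13}R(z_i,z_j)_{12}$$ holds for the colored models. Explicitly: for all $a,b,d,e\in\{+\}\cup\{1,\dots,r\}$ and all subsets $C,D\subseteq\{1,\dots,r\}$, $$\sum_{x,y,M}R_{z_i,z_j}(a,b,x,y)\,T_{z_i}(x,C,d,M)\,T_{z_j}(y,M,e,D)=\sum_{x,y,M}T_{z_j}(b,C,y,M)\,T_{z_i}(a,M,x,D)\,R_{z_i,z_j}(x,y,d,e),$$ where both sums are over $x,y\in\{+\}\cup\{1,\dots,r\}$ and $M\subseteq\{1,\dots,r\}$.
   Context: Colors are the integers $1,\dots,r$. Horizontal edges carry spins in $\{+\}\cup\{1,\dots,r\}$; vertical edges carry spins that are subsets of $\{1,\dots,r\}$. R-vertex weights $R_{z_i,z_j}(a,b,c',d')$, for four horizontal edges in the order (bottom-left, top-left, top-right, bottom-right); $c\ne d$ denote distinct colors, and all configurations not listed have weight $0$: - $(+,+,+,+)$: $z_j-vz_i$; - $(c,c,c,c)$: $z_i-vz_j$; - $(c,d,d,c)$: $(1-v)z_i$ if $c<d$, $(1-v)z_j$ if $c>d$; - $(c,d,c,d)$: $z_i-z_j$ if $c>d$, $v(z_i-z_j)$ if $c<d$; - $(c,+,+,c)$: $(1-v)z_i$; - $(+,c,c,+)$: $(1-v)z_j$; - $(+,c,+,c)$: $v(z_i-z_j)$; - $(c,+,c,+)$: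 $z_i-z_j$. Ordinary (fused) vertex weights $T_z(\text{left},\text{top},\text{right},\text{bottom})$, with $\Sigma\subseteq\{1,\dots,r\}$ and $\Sigma_{[a,b]}=\{k\in\Sigma:a\le k\le b\}$; all configurations not listed have weight $0$: - $(+,\Sigma,+,\Sigma)$: $(-v)^{|\Sigma|}$; - $(c,\Sigma,c,\Sigma)$: $z\,v^{|\Sigma_{[c+1,r]}|}$; - $(+,\Sigma,c,\Sigma\setminus\{c\})$, $c\in\Sigma$: $(-v)^{|\Sigma_{[1,c-1]}|}v^{|\Sigma_{[c+1,r]}|}$; - $(c,\Sigma,+,\Sigma\cup\{c\})$, $c\notin\Sigma$: $(1-v)z(-v)^{|\Sigma_{[c+1,r]}|}$; - $(c,\Sigma,d,(\Sigma\cup\{c\})\setminus\{d\})$, $c<d$, $c\notin\Sigma$, $d\in\Sigma$: $(1-v)z(-v)^{|\Sigma_{[c+1,d-1]}|}v^{|\Sigma_{[d+1,r]}|}$. A vertex with weights $\beta$ defines the endomorphism $a\otimes b\mapsto\sum_{c,d}\beta(a,b,c,d)\,c\otimes d$ of the tensor product of the free vector spaces on the spin sets; the operator form of the equation is shorthand for the explicit identity (in each product the leftmost factor acts first). *)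

theory Defs
  imports Complex_Main
begin

text \<open>The colors are \<open>1, \<dots>, r\<close>; a vertical spin is a subset of \<open>{1..r}\<close>.\<close>

datatype hspin = Plus | Color nat

definition hspins :: "nat \<Rightarrow> hspin set" where
  "hspins r = insert Plus (Color ` {1..r})"

definition vspins :: "nat \<Rightarrow> nat set set" where
  "vspins r = Pow {1..r}"

definition seg :: "nat set \<Rightarrow> nat \<Rightarrow> nat \<Rightarrow> nat set" where
  "seg S a b = {k \<in> S. a \<le> k \<and> k \<le> b}"

text \<open>Argument order of the edges: bottom-left, top-left, top-right, bottom-right.\<close>

definition R_weight ::
  "complex \<Rightarrow> complex \<Rightarrow> complex \<Rightarrow> hspin \<Rightarrow> hspin \<Rightarrow> hspin \<Rightarrow> hspin \<Rightarrow> complex" where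
  "R_weight v zi zj lb lt rt rb =
     (case (lb, lt) of
        (Plus, Plus) \<Rightarrow> (if (rt, rb) = (Plus, Plus) then zj - v * zi else 0)
      | (Color c, Plus) \<Rightarrow>
          (if (rt, rb) = (Plus, Color c) then (1 - v) * zi
           else if (rt, rb) = (Color c, Plus) then zi - zj
           else 0)
      | (Plus, Color c) \<Rightarrow>
          (if (rt, rb) = (Color c, Plus) then (1 - v) * zj
           else if (rt, rb) = (Plus, Color c) then v * (zi - zj)
           else 0)
      | (Color c, Color d) \<Rightarrow>
          (if c = d then (if (rt, rb) = (Color c, Color c) then zi - v * zj else 0)
           else if (rt, rb) = (Color d, Color c) then
             (if c < d then (1 - v) * zi else (1 - v) * zj)
           else if (rt, rb) = (Color c, Color d) then
             (if c > d then zi - zj else v * (zi - zj))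
           else 0))"

text \<open>Argument order of the edges: left, top, right, bottom. The vertical spins \<open>S\<close> and \<open>B\<close>
  are meant to be in \<open>vspins r\<close>.\<close>

definition T_weight ::
  "nat \<Rightarrow> complex \<Rightarrow> complex \<Rightarrow> hspin \<Rightarrow> nat set \<Rightarrow> hspin \<Rightarrow> nat set \<Rightarrow> complex" where
  "T_weight r v z lft S rgt B =
     (case (lft, rgt) of
        (Plus, Plus) \<Rightarrow> (if B = S then (- v) ^ card S else 0)
      | (Plus, Color c) \<Rightarrow>
          (if c \<in> S \<and> B = S - {c}
           then (- v) ^ card (seg S 1 (c - 1)) * v ^ card (seg S (c + 1) r)
           else 0)
      | (Color c, Plus) \<Rightarrow>
          (if c \<notin> S \<and> B = S \<union> {c}
           then (1 - v) * z * (- v) ^ card (seg S (c + 1) r)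
           else 0)
      | (Color c, Color d) \<Rightarrow>
          (if c = d then (if B = S then z * v ^ card (seg S (c + 1) r) else 0)
           else if c < d \<and> c \<notin> S \<and> d \<in> S \<and> B = (S \<union> {c}) - {d}
           then (1 - v) * z * (- v) ^ card (seg S (c + 1) (d - 1)) * v ^ card (seg S (d + 1) r)
           else 0))"

end

theory Submission
  imports Defs
begin

text \<open>Code \<open>+\<close> by \<open>0\<close>. Since \<open>T\<close> conserves colors, the bottom edge is determined by the other three edges,
  and \<open>R\<close> only permutes its two spins, so either side of the equation has at most two nonzero terms.
  The powers of \<open>v\<close> and \<open>-1\<close> in \<open>T\<close> that depend on cardinalities split into one factor for the left and
  one for the right spin. In a product of two vertices the product of these factors changes with the
  order of the two moves only by powers of \<open>v\<close> and signs that compare the spins involved. After cancelling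
  the factors common to all four terms there remains an identity of rational functions that depends
  only on the relative order of \<open>a, b, d, e\<close> and on which of them belong to \<open>C\<close>; it is checked in each case.\<close>

text \<open>This is the \<open>T\<close> weight with \<open>lfac\<close> and \<open>rfac\<close>
  divided out. The factor \<open>- 1 / v\<close> compensates for \<open>lfac\<close>, which counts
  the right color \<open>t\<close> itself among the colors above \<open>l\<close>.\<close>

definition hop :: "complex \<Rightarrow> complex \<Rightarrow> nat set \<Rightarrow> nat \<Rightarrow> nat \<Rightarrow> complex" where
  "hop v z S l t =
     (if l = t then (if l = 0 then 1 else z)
      else if l \<notin> S \<and> (t = 0 \<or> t \<in> S \<and> l < t)
      then (if l = 0 then 1 else (1 - v) * z) * (if t = 0 then 1 else - 1 / v)
      else 0)"

text \<open>Removing \<open>{0}\<close> keeps the code of + out of vertical spins. The case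
  \<open>l = t\<close> is separate because the general formula would delete \<open>l\<close> from an
  \<open>S\<close> containing it.\<close>

definition step :: "nat set \<Rightarrow> nat \<Rightarrow> nat \<Rightarrow> nat set" where
  "step S l t = (if l = t then S else (S \<union> ({l} - {0})) - {t})"

text \<open>The last two factors are the ratios by which \<open>lfac\<close> and \<open>rfac\<close> change under the first move.\<close>

definition hop2 :: "complex \<Rightarrow> complex \<Rightarrow> complex \<Rightarrow> nat set \<Rightarrow> nat \<Rightarrow> nat \<Rightarrow> nat \<Rightarrow> nat \<Rightarrow> complex" where
  "hop2 v z w S x y p q = hop v z S x p * hop v w (step S x p) y q
     * ((if y < x then - v else 1) / (if y < p then - v else 1))
     * (if q = 0 then 1 else (if q < x then - 1 else 1) * (if q < p then - 1 else 1))"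

text \<open>Weight of \<open>(a, b, a, b)\<close>. Off the diagonal, + behaves like a color below
  all others, which its code \<open>0\<close> expresses.\<close>

definition R_same :: "complex \<Rightarrow> complex \<Rightarrow> complex \<Rightarrow> nat \<Rightarrow> nat \<Rightarrow> complex" where
  "R_same v zi zj a b =
     (if a = b then (if a = 0 then zj - v * zi else zi - v * zj)
      else if a > b then zi - zj else v * (zi - zj))"

text \<open>Weight of the exchange \<open>(a, b, b, a)\<close>; here + ranks above all colors
  instead. The value at \<open>a = b\<close> is \<open>0\<close> because \<open>R_same\<close>
  already carries the diagonal weight.\<close>

definition R_swap :: "complex \<Rightarrow> complex \<Rightarrow> complex \<Rightarrow> nat \<Rightarrow> nat \<Rightarrow> complex" where
  "R_swap v zi zj a b =
     (if a = b then 0 else (1 - v) * (if b = 0 \<or> 0 < a \<and> a < b then zi else zj))"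

fun index :: "hspin \<Rightarrow> nat" where
  "index Plus = 0"
| "index (Color c) = c"

definition above :: "nat set \<Rightarrow> nat \<Rightarrow> nat" where
  "above S k = card {j \<in> S. k < j}"

definition lfac :: "complex \<Rightarrow> nat set \<Rightarrow> nat \<Rightarrow> complex" where
  "lfac v S k = (- v) ^ above S k"

definition rfac :: "nat set \<Rightarrow> nat \<Rightarrow> complex" where
  "rfac S k = (if k = 0 then 1 else (- 1) ^ above S k)"

text \<open>The bottom spin after two moves in a form symmetric in \<open>x, y\<close> and in \<open>p, q\<close>: color conservation
  says that \<open>S\<close> with \<open>x\<close> and \<open>y\<close> is, as a multiset, the bottom spin with \<open>p\<close> and \<open>q\<close>.\<close>

definition step2 :: "nat set \<Rightarrow> nat \<Rightarrow> nat \<Rightarrow> nat \<Rightarrow> nat \<Rightarrow> nat set" where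
  "step2 S x y p q = {k. k \<noteq> 0 \<and>
     of_bool (k \<in> S) + of_bool (k = x) + of_bool (k = y)
       = of_bool (k = p) + of_bool (k = q) + (1::nat)}"

lemma step2_commute: "step2 S y x p q = step2 S x y p q" "step2 S x y q p = step2 S x y p q"
  by (simp_all only: step2_def add_ac)

section \<open>Factorization of the weight of a single \<open>T\<close> vertex\<close>

lemma hspins_index:
  assumes "h \<in> hspins r"
  shows "h = Plus \<and> index h = 0 \<or> h = Color (index h) \<and> 0 < index h \<and> index h \<le> r"
  using assms by (auto simp: hspins_def)

lemma finite_spins [simp]: "finite (hspins r)" "finite (vspins r)"
  by (auto simp: hspins_def vspins_def)

lemma seg_above:
  assumes "S \<in> vspins r"
  shows "card (seg S (c + 1) r) = above S c"
  unfolding seg_def above_def using assms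
  by (intro arg_cong[where f = card]) (auto simp: vspins_def)

lemma above_split:
  assumes "finite S" "c \<in> S" "l < c"
  shows "above S l = card (seg S (l + 1) (c - 1)) + 1 + above S c"
proof -
  have "{j \<in> S. l < j} = seg S (l + 1) (c - 1) \<union> ({c} \<union> {j \<in> S. c < j})"
    using assms by (auto simp: seg_def)
  moreover have "card (seg S (l + 1) (c - 1) \<union> ({c} \<union> {j \<in> S. c < j}))
      = card (seg S (l + 1) (c - 1)) + card ({c} \<union> {j \<in> S. c < j})"
    using assms by (intro card_Un_disjoint) (auto simp: seg_def)
  ultimately show ?thesis
    using assms by (simp add: above_def)
qed

lemma above_zero:
  assumes "S \<in> vspins r"
  shows "above S 0 = card S"
  unfolding above_def using assms
  by (intro arg_cong[where f = card]) (auto simp: vspins_def)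

text \<open>For a color \<open>t\<close>, the signs of \<open>lfac\<close> and \<open>rfac\<close>
  cancel for every color above \<open>t\<close>, leaving powers of \<open>v\<close>; the colors of
  \<open>S\<close> strictly between \<open>l\<close> and \<open>t\<close> keep their factor
  \<open>- v\<close>. For \<open>t = 0\<close>, \<open>rfac\<close> is trivial and all colors above
  \<open>l\<close> keep it.\<close>

lemma T_weight_eq:
  assumes v: "v \<noteq> 0" and S: "S \<in> vspins r" and l: "l \<in> hspins r" and t: "t \<in> hspins r"
  shows "T_weight r v z l S t B =
    (if B = step S (index l) (index t)
     then hop v z S (index l) (index t) * lfac v S (index l) * rfac S (index t) else 0)"
proof -
  have fin: "finite S" and z: "0 \<notin> S"
    using S finite_subset by (auto simp: vspins_def)
  have sq: "(- 1) ^ n * (- 1) ^ n = (1 :: complex)" for n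
    by (simp flip: power_mult_distrib)
  note pm = power_minus[of v]
  have split: "above S c = card (seg S (Suc c) (d - 1)) + 1 + above S d" if "d \<in> S" "c < d" for c d
    using above_split[OF fin that] by simp
  note sa = seg_above[OF S, simplified]
  consider "l = Plus" "t = Plus" | d where "l = Plus" "t = Color d" "0 < d"
    | c where "l = Color c" "t = Plus" "0 < c" | c d where "l = Color c" "t = Color d" "0 < c" "0 < d"
    using hspins_index[OF l] hspins_index[OF t] by metis
  then show ?thesis
  proof cases
    case 1
    then show ?thesis
      by (simp add: T_weight_def step_def hop_def lfac_def rfac_def above_zero[OF S])
  next
    case 2
    then show ?thesis
      using z v split[of d 0] sq[of "above S d"]
      by (auto simp: T_weight_def step_def hop_def lfac_def rfac_def sa pm power_add)
  next
    case 3
    then show ?thesis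
      using z by (auto simp: T_weight_def step_def hop_def lfac_def rfac_def sa)
  next
    case 4
    then show ?thesis
      using z v split[of d c] sq[of "above S d"] sq[of "above S c"]
      by (auto simp: T_weight_def step_def hop_def lfac_def rfac_def sa pm power_add)
  qed
qed

section \<open>Products of two \<open>T\<close> vertices\<close>

lemma above_step:
  assumes "finite S" "0 \<notin> S" "x \<noteq> p" "x \<notin> S" "p = 0 \<or> p \<in> S"
  shows "above (step S x p) k + of_bool (k < p) = above S k + of_bool (k < x)"
proof -
  let ?A = "{j \<in> S - {p}. k < j}"
  have "{j \<in> S. k < j} = ?A \<union> (if k < p then {p} else {})"
    "{j \<in> step S x p. k < j} = ?A \<union> (if k < x then {x} else {})"
    using assms by (auto simp: step_def)
  moreover have "finite ?A" "p \<notin> ?A" "x \<notin> ?A"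
    using assms by auto
  ultimately show ?thesis
    unfolding above_def by (auto simp: card_insert_if)
qed

lemma step_vspins:
  assumes "S \<in> vspins r" "x \<le> r"
  shows "step S x p \<in> vspins r"
  using assms by (auto simp: step_def vspins_def)

lemma hop_lfac_rfac:
  assumes "v \<noteq> 0" "finite S" "0 \<notin> S"
  shows "hop v z S x p * hop v w (step S x p) y q * lfac v (step S x p) y * rfac (step S x p) q
    = hop2 v z w S x y p q * lfac v S y * rfac S q"
proof (cases "x = p \<or> hop v z S x p = 0")
  case True
  then show ?thesis
    using assms by (auto simp: hop2_def step_def)
next
  case False
  then have *: "above (step S x p) k + of_bool (k < p) = above S k + of_bool (k < x)" for k
    using assms by (intro above_step) (auto simp: hop_def split: if_splits)
  \<comment> \<open>Exponentiating the additive count identity avoids subtraction of naturals; the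
    ratio then comes from dividing by \<open>1\<close> or \<open>- v\<close>.\<close>
  have "(- v) ^ above (step S x p) y * (- v) ^ of_bool (y < p)
      = (- v) ^ above S y * (- v) ^ of_bool (y < x)"
    by (simp only: * flip: power_add)
  then have 1: "lfac v (step S x p) y
      = lfac v S y * ((if y < x then - v else 1) / (if y < p then - v else 1))"
    using assms(1) by (auto simp: lfac_def field_simps split: if_splits)
  have "(- 1 :: complex) ^ above (step S x p) q * (- 1) ^ of_bool (q < p)
      = (- 1) ^ above S q * (- 1) ^ of_bool (q < x)"
    by (simp only: * flip: power_add)
  then have 2: "rfac (step S x p) q
      = rfac S q * (if q = 0 then 1 else (if q < x then - 1 else 1) * (if q < p then - 1 else 1))"
    by (auto simp: rfac_def minus_equation_iff split: if_splits)
  show ?thesis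
    unfolding 1 2 hop2_def by simp
qed

lemma hop_nonzeroD:
  assumes "hop v z S l t \<noteq> 0"
  shows "l = t \<or> l \<notin> S \<and> (t = 0 \<or> t \<in> S)"
  using assms by (auto simp: hop_def split: if_splits)

text \<open>A nonzero weight forces each move either to change nothing or to add an absent color and
  remove a present one, with + contributing nothing. Multiplicities are therefore conserved, color
  by color.\<close>

lemma step_step:
  assumes "0 \<notin> S" "hop2 v z w S x y p q \<noteq> 0"
  shows "step (step S x p) y q = step2 S x y p q"
proof -
  have "hop v z S x p \<noteq> 0" "hop v w (step S x p) y q \<noteq> 0"
    using assms(2) by (auto simp: hop2_def)
  then have xy: "x = p \<or> x \<notin> S \<and> (p = 0 \<or> p \<in> S)"
    "y = q \<or> y \<notin> step S x p \<and> (q = 0 \<or> q \<in> step S x p)"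
    by (simp_all only: hop_nonzeroD)
  show ?thesis
  proof (rule set_eqI)
    fix k
    show "k \<in> step (step S x p) y q \<longleftrightarrow> k \<in> step2 S x y p q"
      using xy assms(1)
      by (cases "k = 0"; cases "k = x"; cases "k = y"; cases "k = p"; cases "k = q"; cases "k \<in> S")
        (simp_all add: step_def step2_def split: if_splits)
  qed
qed

lemma sum_T_weight:
  assumes v: "v \<noteq> 0" and S: "S \<in> vspins r" and "x \<in> hspins r" "y \<in> hspins r"
    "p \<in> hspins r" "q \<in> hspins r"
  shows "(\<Sum>M\<in>vspins r. T_weight r v z x S p M * T_weight r v w y M q D) =
    of_bool (D = step2 S (index x) (index y) (index p) (index q))
      * (lfac v S (index x) * lfac v S (index y) * rfac S (index p) * rfac S (index q))
      * hop2 v z w S (index x) (index y) (index p) (index q)"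
proof -
  let ?M = "step S (index x) (index p)"
  have fin: "finite S" and z: "0 \<notin> S"
    using S finite_subset by (auto simp: vspins_def)
  have M: "?M \<in> vspins r"
    using S hspins_index[OF assms(3)] by (intro step_vspins) auto
  have "(\<Sum>M\<in>vspins r. T_weight r v z x S p M * T_weight r v w y M q D)
      = (\<Sum>M\<in>vspins r. if M = ?M then hop v z S (index x) (index p) * lfac v S (index x)
           * rfac S (index p) * T_weight r v w y M q D else 0)"
    by (intro sum.cong refl) (simp add: T_weight_eq[OF v S assms(3,5)])
  also have "\<dots> = hop v z S (index x) (index p) * lfac v S (index x) * rfac S (index p)
      * T_weight r v w y ?M q D"
    using M by simp
  also have "\<dots> = of_bool (D = step ?M (index y) (index q)) * (lfac v S (index x) * rfac S (index p))
      * (hop v z S (index x) (index p) * hop v w ?M (index y) (index q)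
          * lfac v ?M (index y) * rfac ?M (index q))"
    by (simp add: T_weight_eq[OF v M assms(4,6)])
  also have "\<dots> = of_bool (D = step ?M (index y) (index q))
      * (lfac v S (index x) * lfac v S (index y) * rfac S (index p) * rfac S (index q))
      * hop2 v z w S (index x) (index y) (index p) (index q)"
    by (simp add: hop_lfac_rfac[OF v fin z])
  \<comment> \<open>If \<open>hop2\<close> vanishes, both sides are \<open>0\<close>, so the bottom
    spin may be rewritten without assuming that the moves are admissible.\<close>
  also have "\<dots> = of_bool (D = step2 S (index x) (index y) (index p) (index q))
      * (lfac v S (index x) * lfac v S (index y) * rfac S (index p) * rfac S (index q))
      * hop2 v z w S (index x) (index y) (index p) (index q)"
    using step_step[OF z] by (cases "hop2 v z w S (index x) (index y) (index p) (index q) = 0") auto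
  finally show ?thesis .
qed

section \<open>The \<open>R\<close> vertex as identity plus exchange\<close>

lemma R_weight_eq:
  assumes "a \<in> hspins r" "b \<in> hspins r" "x \<in> hspins r" "y \<in> hspins r"
  shows "R_weight v zi zj a b x y =
    (if x = a then if y = b then R_same v zi zj (index a) (index b) else 0 else 0)
    + (if x = b then if y = a then R_swap v zi zj (index a) (index b) else 0 else 0)"
  using hspins_index[OF assms(1)] hspins_index[OF assms(2)]
  by (cases a; cases b) (auto simp: R_weight_def R_same_def R_swap_def)

text \<open>The same two entries read from the right edges. In an exchange the left pair is
  \<open>(e, d)\<close>, hence the reversed arguments of \<open>R_swap\<close>.\<close>

lemma R_weight_eq':
  assumes "x \<in> hspins r" "y \<in> hspins r" "d \<in> hspins r" "e \<in> hspins r"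
  shows "R_weight v zi zj x y d e =
    (if x = d then if y = e then R_same v zi zj (index d) (index e) else 0 else 0)
    + (if x = e then if y = d then R_swap v zi zj (index e) (index d) else 0 else 0)"
  using R_weight_eq[OF assms] by auto

lemma sum_delta2:
  fixes f :: "'a \<Rightarrow> 'a \<Rightarrow> 'b::semiring_0"
  assumes "finite A" "g \<in> A" "h \<in> A"
  shows "(\<Sum>x\<in>A. \<Sum>y\<in>A. (if x = g then if y = h then s else 0 else 0) * f x y) = s * f g h"
proof -
  have "(\<Sum>x\<in>A. \<Sum>y\<in>A. (if x = g then if y = h then s else 0 else 0) * f x y)
      = (\<Sum>x\<in>A. if x = g then \<Sum>y\<in>A. if y = h then s * f x y else 0 else 0)"
    by (intro sum.cong refl) (auto intro!: sum.cong)
  then show ?thesis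
    using assms by simp
qed

lemma sum_R_weight_right:
  assumes "a \<in> hspins r" "b \<in> hspins r"
  shows "(\<Sum>x\<in>hspins r. \<Sum>y\<in>hspins r. R_weight v zi zj a b x y * f x y)
    = R_same v zi zj (index a) (index b) * f a b + R_swap v zi zj (index a) (index b) * f b a"
proof -
  have "(\<Sum>x\<in>hspins r. \<Sum>y\<in>hspins r. R_weight v zi zj a b x y * f x y)
    = (\<Sum>x\<in>hspins r. \<Sum>y\<in>hspins r.
        (if x = a then if y = b then R_same v zi zj (index a) (index b) else 0 else 0) * f x y
        + (if x = b then if y = a then R_swap v zi zj (index a) (index b) else 0 else 0) * f x y)"
    by (intro sum.cong refl) (simp only: R_weight_eq[OF assms] distrib_right)
  then show ?thesis
    by (simp only: sum.distrib sum_delta2[OF finite_spins(1) assms]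
        sum_delta2[OF finite_spins(1) assms(2,1)])
qed

lemma sum_R_weight_left:
  assumes "d \<in> hspins r" "e \<in> hspins r"
  shows "(\<Sum>x\<in>hspins r. \<Sum>y\<in>hspins r. R_weight v zi zj x y d e * f x y)
    = R_same v zi zj (index d) (index e) * f d e + R_swap v zi zj (index e) (index d) * f e d"
proof -
  have "(\<Sum>x\<in>hspins r. \<Sum>y\<in>hspins r. R_weight v zi zj x y d e * f x y)
    = (\<Sum>x\<in>hspins r. \<Sum>y\<in>hspins r.
        (if x = d then if y = e then R_same v zi zj (index d) (index e) else 0 else 0) * f x y
        + (if x = e then if y = d then R_swap v zi zj (index e) (index d) else 0 else 0) * f x y)"
    by (intro sum.cong refl) (simp only: R_weight_eq'[OF _ _ assms] distrib_right)
  then show ?thesis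
    by (simp only: sum.distrib sum_delta2[OF finite_spins(1) assms]
        sum_delta2[OF finite_spins(1) assms(2,1)])
qed

text \<open>No cardinality of \<open>S\<close> is left, so finitely many configurations remain, and
  every denominator is a power of \<open>v\<close> up to sign. On the right \<open>b\<close> moves
  first, with parameter \<open>zj\<close>.\<close>

lemma hop2_yang_baxter:
  assumes v: "v \<noteq> 0" and S: "0 \<notin> S"
  shows "R_same v zi zj a b * hop2 v zi zj S a b d e + R_swap v zi zj a b * hop2 v zi zj S b a d e
       = R_same v zi zj d e * hop2 v zj zi S b a e d + R_swap v zi zj e d * hop2 v zj zi S b a d e"
  using assms
  \<comment> \<open>The pairwise comparisons include contradictory orders, which
    \<open>linarith\<close> discards; membership in \<open>S\<close> and equality with
    \<open>0\<close> are split during simplification.\<close>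
  apply (cases a b rule: linorder_cases; cases d e rule: linorder_cases;
      cases a d rule: linorder_cases; cases a e rule: linorder_cases;
      cases b d rule: linorder_cases; cases b e rule: linorder_cases; linarith?)
  apply (simp_all add: hop2_def hop_def step_def R_same_def R_swap_def)
  apply (simp_all add: field_simps)
  done

theorem theorem6p5:
  fixes r :: nat and v zi zj :: complex
    and a b d e :: hspin and C D :: "nat set"
  assumes "r \<ge> 1" and "v \<noteq> 0" and "zi \<noteq> 0" and "zj \<noteq> 0"
    and "a \<in> hspins r" and "b \<in> hspins r" and "d \<in> hspins r" and "e \<in> hspins r"
    and "C \<in> vspins r" and "D \<in> vspins r"
  shows "(\<Sum>x\<in>hspins r. \<Sum>y\<in>hspins r. \<Sum>M\<in>vspins r.
            R_weight v zi zj a b x y * T_weight r v zi x C d M * T_weight r v zj y M e D)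
       = (\<Sum>x\<in>hspins r. \<Sum>y\<in>hspins r. \<Sum>M\<in>vspins r.
            T_weight r v zj b C y M * T_weight r v zi a M x D * R_weight v zi zj x y d e)"
    (is "?L = ?R")
proof -
  note H = assms(5-8)
  define L where "L x y = (\<Sum>M\<in>vspins r. T_weight r v zi x C d M * T_weight r v zj y M e D)" for x y
  define R where "R x y = (\<Sum>M\<in>vspins r. T_weight r v zj b C y M * T_weight r v zi a M x D)" for x y
  \<comment> \<open>All these factors are evaluated at \<open>C\<close>, not at an intermediate
    spin, and the product is symmetric in \<open>a, b\<close> and in \<open>d, e\<close>; hence all
    four terms share it.\<close>
  define K where "K = of_bool (D = step2 C (index a) (index b) (index d) (index e))
    * (lfac v C (index a) * lfac v C (index b) * rfac C (index d) * rfac C (index e))"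
  note step2_swap = step2_commute(1)[of C "index a" "index b"]
    step2_commute(2)[of C _ _ "index d" "index e"]
  have "?L = (\<Sum>x\<in>hspins r. \<Sum>y\<in>hspins r. R_weight v zi zj a b x y * L x y)"
    by (simp only: L_def sum_distrib_left mult.assoc)
  also have "\<dots> = R_same v zi zj (index a) (index b) * L a b + R_swap v zi zj (index a) (index b) * L b a"
    by (rule sum_R_weight_right[OF H(1,2)])
  also have "\<dots> = K * (R_same v zi zj (index a) (index b) * hop2 v zi zj C (index a) (index b) (index d) (index e)
      + R_swap v zi zj (index a) (index b) * hop2 v zi zj C (index b) (index a) (index d) (index e))"
    unfolding L_def K_def sum_T_weight[OF assms(2,9) H(1,2,3,4)] sum_T_weight[OF assms(2,9) H(2,1,3,4)] step2_swap
    by (simp only: algebra_simps)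
  also have "\<dots> = K * (R_same v zi zj (index d) (index e) * hop2 v zj zi C (index b) (index a) (index e) (index d)
      + R_swap v zi zj (index e) (index d) * hop2 v zj zi C (index b) (index a) (index d) (index e))"
    using assms(9) by (subst hop2_yang_baxter[OF assms(2)]) (auto simp: vspins_def)
  also have "\<dots> = R_same v zi zj (index d) (index e) * R d e + R_swap v zi zj (index e) (index d) * R e d"
    unfolding R_def K_def sum_T_weight[OF assms(2,9) H(2,1,4,3)] sum_T_weight[OF assms(2,9) H(2,1,3,4)] step2_swap
    by (simp only: algebra_simps)
  also have "\<dots> = (\<Sum>x\<in>hspins r. \<Sum>y\<in>hspins r. R_weight v zi zj x y d e * R x y)"
    by (rule sum_R_weight_left[OF H(3,4), symmetric])
  also have "\<dots> = ?R"
    by (simp only: R_def sum_distrib_left mult_ac)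
  finally show ?thesis .
qed

end
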